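(* Let $G$ be a totally regular bipartite mixed graph with undirected degree $r=1$, directed degree $z=1$, and diameter $k$, and let $N$ be its order (number of vertices). (i) If $k=2\kappa$ with $\kappa\ge 3$, then $$N\le M_B(1,1,2\kappa)-2\left\lceil\frac{\kappa}{3}\right\rceil-2\sum_{t=2}^{\kappa-1}\frac{1}{2^{2t-2}\sqrt5}\Big((1+\sqrt5)^{2t-2}-(1-\sqrt5)^{2t-2}\Big)\left\lceil\frac{\kappa-t+1}{3}\right\rceil .$$ (ii) If $k=2\kappa$ with $\kappa=2$, then $N\le M_B(1,1,2\kappa)-2\left\lceil\frac{\kappa}{3}\right\rceil$. (iii) If $k=2\kappa+1$ with $\kappa\ge 2$, then $$N\le M_B(1,1,2\kappa+1)-2\sum_{t=1}^{\kappa-1}\frac{1}{2^{2t-1}\sqrt5}\Big((1+\sqrt5)^{2t-1}-(1-\sqrt5)^{2t-1}\Big)\left\lceil\frac{\kappa-t+1}{3}\right\rceil .$$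
   Context: A mixed graph has a finite vertex set and may contain undirected edges as well as directed edges (arcs). The undirected degree of a vertex is the number of edges incident to it; its out-degree (in-degree) is the number of arcs leaving (entering) it. A mixed graph is totally regular with undirected degree $r$ and directed degree $z$ if every vertex has undirected degree $r$ and both in-degree and out-degree equal to $z$. It is bipartite if its vertex set can be partitioned into two sets such that every edge and every arc joins vertices from different sets. The distance from $u$ to $v$ is the length of a shortest path from $u$ to $v$, where edges may be traversed in both directions and arcs only along their orientation; the diameter is the maximum distance over all ordered pairs of vertices. $M_B(1,1,k)$ denotes the Moore bound for bipartite mixed graphs with $r=z=1$ and diameter $k$: $$M_B(1,1,k)=2\left(A\,\frac{u_1^{k+1}-u_1}{u_1^2-1}+B\,\frac{u_2^{k+1}-u_2}{u_2^2-1}\right),$$ where $u_1=\frac{1-\sqrt5}{2}$, $u_2=\frac{1+\sqrt5}{2}$, $A=\frac{\sqrt5-3}{2\sqrt5}$, $B=\frac{\sqrt5+3}{2\sqrt5}$. Equivalently, $M_B(1,1,1)=2$, $M_B(1,1,2)=4$ and $M_B(1,1,k)=M_B(1,1,k-1)+M_B(1,1,k-2)+2$ for $k\ge 3$. *)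

theory Defs
  imports Complex_Main "HOL-Library.Extended_Nat"
begin

record 'a mixed_graph =
  verts :: "'a set"
  edges :: "'a set set"
  arcs :: "('a \<times> 'a) set"

text \<open>Loops are excluded; an edge and an arc, or two opposite arcs, may join the same two
  vertices. Parallel edges and parallel arcs with the same direction are not represented; neither
  can occur once every vertex has undirected degree 1 and out-degree 1.\<close>

definition mixed_graph :: "('a, 'b) mixed_graph_scheme \<Rightarrow> bool" where
  "mixed_graph G \<longleftrightarrow> finite (verts G)
     \<and> (\<forall>e\<in>edges G. e \<subseteq> verts G \<and> card e = 2)
     \<and> (\<forall>(u, v)\<in>arcs G. u \<in> verts G \<and> v \<in> verts G \<and> u \<noteq> v)"

definition undirected_degree :: "('a, 'b) mixed_graph_scheme \<Rightarrow> 'a \<Rightarrow> nat" where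
  "undirected_degree G v = card {e \<in> edges G. v \<in> e}"

definition out_degree :: "('a, 'b) mixed_graph_scheme \<Rightarrow> 'a \<Rightarrow> nat" where
  "out_degree G v = card {a \<in> arcs G. fst a = v}"

definition in_degree :: "('a, 'b) mixed_graph_scheme \<Rightarrow> 'a \<Rightarrow> nat" where
  "in_degree G v = card {a \<in> arcs G. snd a = v}"

definition totally_regular :: "('a, 'b) mixed_graph_scheme \<Rightarrow> nat \<Rightarrow> nat \<Rightarrow> bool" where
  "totally_regular G r z \<longleftrightarrow>
     (\<forall>v\<in>verts G. undirected_degree G v = r \<and> in_degree G v = z \<and> out_degree G v = z)"

definition bipartite :: "('a, 'b) mixed_graph_scheme \<Rightarrow> bool" where
  "bipartite G \<longleftrightarrow> (\<exists>X Y. X \<union> Y = verts G \<and> X \<inter> Y = {}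
     \<and> (\<forall>e\<in>edges G. \<exists>x\<in>X. \<exists>y\<in>Y. e = {x, y})
     \<and> (\<forall>(u, v)\<in>arcs G. u \<in> X \<and> v \<in> Y \<or> u \<in> Y \<and> v \<in> X))"

definition step :: "('a, 'b) mixed_graph_scheme \<Rightarrow> 'a \<Rightarrow> 'a \<Rightarrow> bool" where
  "step G u v \<longleftrightarrow> {u, v} \<in> edges G \<or> (u, v) \<in> arcs G"

definition is_path :: "('a, 'b) mixed_graph_scheme \<Rightarrow> 'a \<Rightarrow> 'a list \<Rightarrow> 'a \<Rightarrow> bool" where
  "is_path G u p v \<longleftrightarrow> p \<noteq> [] \<and> hd p = u \<and> last p = v \<and> set p \<subseteq> verts G
     \<and> distinct p \<and> successively (step G) p"

text \<open>The distance is \<open>\<infinity>\<close>, the infimum of the empty set, if no path exists.\<close>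

definition distance :: "('a, 'b) mixed_graph_scheme \<Rightarrow> 'a \<Rightarrow> 'a \<Rightarrow> enat" where
  "distance G u v = (INF p\<in>{p. is_path G u p v}. enat (length p - 1))"

definition diameter :: "('a, 'b) mixed_graph_scheme \<Rightarrow> enat" where
  "diameter G = (SUP (u, v)\<in>verts G \<times> verts G. distance G u v)"

text \<open>\<open>M\<^sub>B(1,1,k)\<close>: undirected degree 1, directed degree 1, diameter \<open>k\<close>.\<close>

definition moore_bound_bip11 :: "nat \<Rightarrow> real" where
  "moore_bound_bip11 k =
     (let u1 = (1 - sqrt 5) / 2; u2 = (1 + sqrt 5) / 2;
          A = (sqrt 5 - 3) / (2 * sqrt 5); B = (sqrt 5 + 3) / (2 * sqrt 5)
      in 2 * (A * ((u1 ^ (k + 1) - u1) / (u1\<^sup>2 - 1)) + B * ((u2 ^ (k + 1) - u2) / (u2\<^sup>2 - 1))))"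

lemma moore_bound_bip11_rec:
  "moore_bound_bip11 1 = 2" "moore_bound_bip11 2 = 4"
  "moore_bound_bip11 (k + 2) = moore_bound_bip11 (k + 1) + moore_bound_bip11 k + 2"
proof -
  define a where "a = (1 - sqrt 5) / 2"
  define b where "b = (1 + sqrt 5) / 2"
  define A where "A = (sqrt 5 - 3) / (2 * sqrt 5)"
  define B where "B = (sqrt 5 + 3) / (2 * sqrt 5)"
  have a2: "a\<^sup>2 = a + 1" and b2: "b\<^sup>2 = b + 1"
    by (simp_all add: a_def b_def power2_eq_square field_simps)
  have a0: "a \<noteq> 0" using a2 by auto
  have b0: "b \<noteq> 0" using b2 by auto
  have M: "moore_bound_bip11 n = 2 * (A * (a ^ n - 1) + B * (b ^ n - 1))" for n
  proof -
    have "(a ^ (n + 1) - a) / (a\<^sup>2 - 1) = a ^ n - 1"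
      "(b ^ (n + 1) - b) / (b\<^sup>2 - 1) = b ^ n - 1"
      using a0 b0 by (simp_all add: a2 b2 field_simps)
    then show ?thesis
      unfolding moore_bound_bip11_def Let_def a_def [symmetric] b_def [symmetric]
        A_def [symmetric] B_def [symmetric] by simp
  qed
  have AB: "A + B = 1"
    by (simp add: A_def B_def field_simps)
  have AaBb: "A * a + B * b = 2"
    by (simp add: A_def B_def a_def b_def field_simps)
  show "moore_bound_bip11 1 = 2"
    using AB AaBb by (simp add: M algebra_simps)
  show "moore_bound_bip11 2 = 4"
    using AB AaBb by (simp add: M a2 b2 algebra_simps)
  have "a ^ (k + 2) = a ^ (k + 1) + a ^ k" "b ^ (k + 2) = b ^ (k + 1) + b ^ k"
    by (simp_all only: power_add a2 b2 power_one_right) (simp_all add: algebra_simps)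
  then show "moore_bound_bip11 (k + 2) = moore_bound_bip11 (k + 1) + moore_bound_bip11 k + 2"
    using AB by (simp only: M) (simp add: algebra_simps)
qed

end

theory Submission
  imports Defs "HOL-Number_Theory.Fib"
begin

text \<open>The edges form a fixed-point-free involution \<open>a\<close> and the arcs a permutation \<open>f\<close>, so walks are
  words in \<open>a\<close>, \<open>f\<close>, and shortest paths are words without \<open>aa\<close>. Since the graph is bipartite, from
  every root \<open>r\<close> the words of length at most \<open>k - 1\<close> and parity \<open>k - 1\<close> already reach a whole side,
  and there are \<open>M\<^sub>B(1,1,k) / 2\<close> of them. The bound improves by the number of words that can be
  dropped without losing a vertex.

  Fix an edge \<open>{v, w}\<close> and compare the words from \<open>v\<close> and \<open>w\<close> with those from \<open>u = f(w)\<close>. Let \<open>g\<close>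
  be a word of length at most \<open>k - 3\<close> and parity \<open>k - 1\<close> that starts and ends with \<open>f\<close>. The
  vertex \<open>v\<cdot>g\<close> is also \<open>u\<cdot>W\<close> for some \<open>W\<close>. If \<open>W\<close> has length at most \<open>k - 3\<close>, then \<open>g\<close> is
  redundant at \<open>v\<close>, being equivalent to \<open>afW\<close>. Otherwise cancelling the last letter of \<open>W\<close> shows
  that \<open>ag\<close> without its last letter, or \<open>aga\<close>, is equivalent at \<open>w\<close> to an \<open>f\<close>-word of maximal
  length \<open>k - 1\<close>. Words \<open>g\<close> and \<open>g'\<close> yield the same redundant word only if one is the other
  followed by \<open>af\<close>, so selecting every second word of each chain \<open>g, gaf, gafaf, \<dots>\<close> yields
  distinct redundant words. A chain with \<open>m\<close> words of length at most \<open>k - 1\<close> contributes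
  \<open>\<lfloor>m/2\<rfloor> \<ge> \<lceil>m/3\<rceil>\<close> of them if \<open>m \<ge> 2\<close>, and the number of chains of each length is a
  Fibonacci number.\<close>

section \<open>Words without two consecutive edges\<close>

text \<open>In a word \<open>True\<close> stands for the edge and \<open>False\<close> for the outgoing arc.\<close>

definition reduced :: "bool list \<Rightarrow> bool" where
  "reduced = successively (\<lambda>x y. \<not> (x \<and> y))"

lemma reduced_simps [simp]:
  "reduced []" "reduced [c]" "reduced (False # W) = reduced W"
  "reduced (True # W) \<longleftrightarrow> reduced W \<and> (W = [] \<or> \<not> hd W)"
  by (cases W; auto simp: reduced_def)+

lemma reduced_append:
  "reduced (W @ W') \<longleftrightarrow> reduced W \<and> reduced W' \<and> (W = [] \<or> W' = [] \<or> \<not> (last W \<and> hd W'))"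
  by (auto simp: reduced_def successively_append_iff)

section \<open>Fibonacci counts of words\<close>

definition words :: "nat \<Rightarrow> bool list set" where
  "words n = {W. length W = n \<and> reduced W}"

lemma finite_words: "finite (words n)"
  by (rule finite_subset[OF _ finite_lists_length_eq[of UNIV n]]) (auto simp: words_def)

lemma words_Suc_Suc:
  "words (Suc (Suc n)) = (#) False ` words (Suc n) \<union> (\<lambda>W. True # False # W) ` words n"
proof (intro equalityI subsetI)
  fix W assume W: "W \<in> words (Suc (Suc n))"
  then obtain c d V where "W = c # d # V"
    by (auto simp: words_def length_Suc_conv)
  with W show "W \<in> (#) False ` words (Suc n) \<union> (\<lambda>W. True # False # W) ` words n"
    by (cases c; cases d) (auto simp: words_def)
qed (auto simp: words_def)

lemma card_words: "card (words n) = fib (n + 2)"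
proof (induction n rule: fib.induct)
  case 1
  have "words 0 = {[]}" by (auto simp: words_def)
  then show ?case by simp
next
  case 2
  have "words (Suc 0) = {[True], [False]}" by (auto simp: words_def length_Suc_conv)
  then show ?case by (simp add: numeral_eq_Suc)
next
  case (3 n)
  have "card (words (Suc (Suc n))) = card (words (Suc n)) + card (words n)"
    unfolding words_Suc_Suc
    by (subst card_Un_disjoint) (auto simp: finite_words card_image inj_on_def)
  with 3 show ?case by (simp add: numeral_eq_Suc)
qed

definition parity_words :: "nat \<Rightarrow> bool list set" where
  "parity_words n = {W. reduced W \<and> length W \<le> n \<and> (even (length W) \<longleftrightarrow> even n)}"

lemma parity_words_Suc_Suc: "parity_words (Suc (Suc n)) = parity_words n \<union> words (Suc (Suc n))"
  by (auto simp: parity_words_def words_def le_Suc_eq)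

text \<open>The layer \<open>words (n + 2)\<close> contributes \<open>fib (n + 4)\<close>, and
  \<open>fib (n + 3) + fib (n + 4) = fib (n + 5)\<close>.\<close>

lemma finite_card_parity_words: "finite (parity_words n) \<and> card (parity_words n) + 1 = fib (n + 3)"
proof (induction n rule: fib.induct)
  case 1
  have "parity_words 0 = {[]}" by (auto simp: parity_words_def)
  then show ?case by (simp add: numeral_eq_Suc)
next
  case 2
  have "parity_words (Suc 0) = {[True], [False]}"
    by (auto simp: parity_words_def le_Suc_eq length_Suc_conv)
  then show ?case by (simp add: numeral_eq_Suc)
next
  case (3 n)
  have "card (parity_words (Suc (Suc n))) = card (parity_words n) + card (words (Suc (Suc n)))"
    unfolding parity_words_Suc_Suc
  proof (rule card_Un_disjoint)
    show "parity_words n \<inter> words (Suc (Suc n)) = {}"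
      by (auto simp: parity_words_def words_def)
  qed (use 3(2) in \<open>auto simp: finite_words\<close>)
  with 3 show ?case by (simp add: finite_words card_words parity_words_Suc_Suc numeral_eq_Suc)
qed

definition arc_words :: "nat \<Rightarrow> bool list set" where
  "arc_words n = {g \<in> words n. g \<noteq> [] \<and> \<not> hd g \<and> \<not> last g}"

text \<open>For \<open>n >= 2\<close>, removing the arc at each end leaves an arbitrary reduced word
  of length \<open>n - 2\<close>.\<close>

lemma card_arc_words: "card (arc_words n) = fib n"
proof (cases n rule: fib.cases)
  case 1
  then have "arc_words n = {}" by (auto simp: arc_words_def words_def)
  with 1 show ?thesis by simp
next
  case 2
  then have "arc_words n = {[False]}" by (auto simp: arc_words_def words_def length_Suc_conv)
  with 2 show ?thesis by simp
next
  case (3 m)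
  have "arc_words n = (\<lambda>V. False # V @ [False]) ` words m"
  proof (intro equalityI subsetI)
    fix g assume g: "g \<in> arc_words n"
    then obtain V where "g = False # V" "V \<noteq> []"
      using 3 by (cases g; cases "tl g") (auto simp: arc_words_def words_def)
    moreover from this obtain V' where "V = V' @ [False]"
      using g by (cases V rule: rev_cases) (auto simp: arc_words_def)
    ultimately show "g \<in> (\<lambda>V. False # V @ [False]) ` words m"
      using g 3 by (auto simp: arc_words_def words_def reduced_append)
  qed (auto simp: arc_words_def words_def reduced_append 3)
  then show ?thesis using 3
    by (simp add: card_image inj_on_def card_words)
qed

lemma finite_arc_words: "finite (arc_words n)"
  by (auto simp: arc_words_def finite_words)

text \<open>Every second word of each chain \<open>g, gaf, gafaf, \<dots>\<close>\<close>

fun sel :: "nat \<Rightarrow> bool list set" where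
  "sel 0 = arc_words 0"
| "sel (Suc 0) = arc_words (Suc 0)"
| "sel (Suc (Suc n)) = arc_words (Suc (Suc n)) - (\<lambda>g. g @ [True, False]) ` sel n"

lemma sel_subset: "sel n \<subseteq> arc_words n"
  by (cases n rule: sel.cases) auto

text \<open>Appending \<open>af\<close> embeds \<open>sel n\<close> into
  \<open>arc_words (n + 2)\<close>, and \<open>sel (n + 2)\<close> is the complement of the
  image.\<close>

lemma card_sel: "card (sel (Suc (Suc n))) + card (sel n) = fib (Suc (Suc n))"
proof -
  let ?h = "\<lambda>g. g @ [True, False]"
  have "?h ` sel n \<subseteq> arc_words (Suc (Suc n))"
    using sel_subset[of n] by (auto simp: arc_words_def words_def reduced_append)
  moreover have "card (?h ` sel n) = card (sel n)"
    by (simp add: card_image inj_on_def)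
  ultimately show ?thesis
    using card_arc_words[of "Suc (Suc n)"] card_mono[of "arc_words (Suc (Suc n))" "?h ` sel n"]
    by (simp add: card_Diff_subset finite_arc_words finite_subset del: fib.simps)
qed

definition sel_upto :: "nat \<Rightarrow> bool list set" where
  "sel_upto n = {g. length g \<le> n \<and> (even (length g) \<longleftrightarrow> even n) \<and> g \<in> sel (length g)}"

lemma length_sel: "g \<in> sel n \<Longrightarrow> length g = n"
  using sel_subset by (auto simp: arc_words_def words_def)

lemma finite_sel: "finite (sel n)"
  using finite_subset[OF sel_subset finite_arc_words] .

lemma sel_upto_Suc_Suc: "sel_upto (Suc (Suc n)) = sel_upto n \<union> sel (Suc (Suc n))"
  by (auto simp: sel_upto_def le_Suc_eq length_sel simp del: sel.simps(3))

lemma sel_upto_small: "sel_upto 0 = {}" "sel_upto (Suc 0) = sel (Suc 0)"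
  by (auto simp: sel_upto_def arc_words_def words_def le_Suc_eq)

lemma finite_sel_upto: "finite (sel_upto n)"
  by (induction n rule: sel.induct)
    (simp_all add: sel_upto_small sel_upto_Suc_Suc finite_sel finite_arc_words)

lemma card_sel_upto_Suc_Suc:
  "card (sel_upto (Suc (Suc n))) = card (sel_upto n) + card (sel (Suc (Suc n)))"
  unfolding sel_upto_Suc_Suc
proof (rule card_Un_disjoint)
  show "sel_upto n \<inter> sel (Suc (Suc n)) = {}"
    by (auto simp: sel_upto_def simp del: sel.simps(3) dest: length_sel)
qed (rule finite_sel_upto finite_sel)+

text \<open>By \<open>card_sel\<close>, the two new layers \<open>sel (n + 2)\<close> and
  \<open>sel (n + 4)\<close> together have \<open>fib (n + 4)\<close> elements.\<close>

lemma card_sel_upto_add4: "card (sel_upto (n + 4)) = card (sel_upto n) + fib (n + 4)"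
  using card_sel[of "n + 2"]
  by (simp add: numeral_eq_Suc card_sel_upto_Suc_Suc del: sel.simps(3) fib.simps)

lemma card_sel_upto_base:
  "card (sel_upto 0) = 0" "card (sel_upto 1) = 1" "card (sel_upto 2) = 1" "card (sel_upto 3) = 2"
proof -
  have s0: "sel 0 = {}" by (auto simp: arc_words_def words_def)
  have s1: "card (sel (Suc 0)) = 1" by (simp add: card_arc_words)
  have s2: "card (sel (Suc (Suc 0))) = 1" using card_sel[of 0] by (simp add: s0 del: sel.simps)
  have s3: "card (sel (Suc (Suc (Suc 0)))) = 1" using card_sel[of "Suc 0"] s1 by (simp del: sel.simps)
  show "card (sel_upto 0) = 0" "card (sel_upto 1) = 1" "card (sel_upto 2) = 1" "card (sel_upto 3) = 2"
    using s1 s2 s3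
    by (simp_all add: numeral_eq_Suc card_sel_upto_Suc_Suc sel_upto_small del: sel.simps)
qed

section \<open>Closed forms for the number of selected words\<close>

lemma sum_fib_even: "(\<Sum>j\<le>n. fib (2 * j)) + 1 = fib (2 * n + 1)"
  by (induction n) simp_all

lemma sum_fib_odd: "(\<Sum>j\<le>n. fib (2 * j + 1)) = fib (2 * n + 2)"
  by (induction n) simp_all

text \<open>For \<open>j > 0\<close>, \<open>fib (2 * j)\<close> chains start at length
  \<open>2 * j + 1\<close>, each with \<open>n + 2 - j\<close> words of length at most
  \<open>2 * n + 3\<close>. The chain of the single arc gives the separate term.\<close>

lemma card_sel_upto_odd:
  "card (sel_upto (2 * n + 1)) = (n + 2) div 2 + (\<Sum>j\<le>n + 2. fib (2 * j) * ((n + 2 - j) div 2))"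
proof (induction n rule: fib.induct)
  case 1
  show ?case using card_sel_upto_base by (simp add: numeral_eq_Suc)
next
  case 2
  have "3 div 2 = (1::nat)" by simp
  then show ?case using card_sel_upto_base by (simp add: numeral_eq_Suc)
next
  case (3 n)
  \<comment> \<open>The terms \<open>j = n + 3\<close> and \<open>j = n + 4\<close> vanish because
    \<open>1 div 2 = 0\<close>.\<close>
  have "(\<Sum>j\<le>n + 4. fib (2 * j) * ((n + 4 - j) div 2))
      = (\<Sum>j\<le>n + 2. fib (2 * j) * ((n + 4 - j) div 2))"
    by (simp add: numeral_eq_Suc)
  also have "\<dots> = (\<Sum>j\<le>n + 2. fib (2 * j) * ((n + 2 - j) div 2) + fib (2 * j))"
  proof (rule sum.cong[OF refl])
    fix j assume "j \<in> {..n + 2}"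
    then have "(n + 4 - j) div 2 = (n + 2 - j) div 2 + 1"
      by (simp only: atMost_iff)
    then show "fib (2 * j) * ((n + 4 - j) div 2) = fib (2 * j) * ((n + 2 - j) div 2) + fib (2 * j)"
      by simp
  qed
  also have "\<dots> = (\<Sum>j\<le>n + 2. fib (2 * j) * ((n + 2 - j) div 2)) + (\<Sum>j\<le>n + 2. fib (2 * j))"
    by (rule sum.distrib)
  finally have "(\<Sum>j\<le>n + 4. fib (2 * j) * ((n + 4 - j) div 2)) = \<dots>" .
  moreover have idx: "2 * (n + 2) + 1 = 2 * n + 5" "2 * n + 1 + 4 = 2 * n + 5"
    "2 * Suc (Suc n) + 1 = 2 * n + 5" "Suc (Suc n) + 2 = n + 4"
    by simp_all
  moreover have "(\<Sum>j\<le>n + 2. fib (2 * j)) + 1 = fib (2 * n + 5)"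
    using sum_fib_even[of "n + 2"] unfolding idx .
  moreover have "card (sel_upto (2 * n + 5)) = card (sel_upto (2 * n + 1)) + fib (2 * n + 5)"
    using card_sel_upto_add4[of "2 * n + 1"] unfolding idx .
  moreover have "(n + 4) div 2 = (n + 2) div 2 + 1" by simp
  ultimately show ?case using 3(2) unfolding idx by linarith
qed

text \<open>Here \<open>fib (2 * j + 1)\<close> chains start at length \<open>2 * j + 2\<close>,
  each with \<open>n + 1 - j\<close> words of length at most \<open>2 * n + 2\<close>.\<close>

lemma card_sel_upto_even:
  "card (sel_upto (2 * n)) = (\<Sum>j\<le>n. fib (2 * j + 1) * ((n + 1 - j) div 2))"
proof (induction n rule: fib.induct)
  case 1
  show ?case using card_sel_upto_base by simp
next
  case 2
  show ?case using card_sel_upto_base by (simp add: numeral_eq_Suc)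
next
  case (3 n)
  have "(\<Sum>j\<le>n + 2. fib (2 * j + 1) * ((n + 3 - j) div 2))
      = (\<Sum>j\<le>n + 1. fib (2 * j + 1) * ((n + 3 - j) div 2))"
    by (simp add: numeral_eq_Suc)
  also have "\<dots> = (\<Sum>j\<le>n + 1. fib (2 * j + 1) * ((n + 1 - j) div 2) + fib (2 * j + 1))"
  proof (rule sum.cong[OF refl])
    fix j assume "j \<in> {..n + 1}"
    then have "(n + 3 - j) div 2 = (n + 1 - j) div 2 + 1"
      by (simp only: atMost_iff)
    then show "fib (2 * j + 1) * ((n + 3 - j) div 2)
        = fib (2 * j + 1) * ((n + 1 - j) div 2) + fib (2 * j + 1)"
      by simp
  qed
  also have "\<dots> = (\<Sum>j\<le>n. fib (2 * j + 1) * ((n + 1 - j) div 2)) + fib (2 * n + 4)"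
    using sum_fib_odd[of "n + 1"] by (simp only: sum.distrib) (simp add: algebra_simps numeral_eq_Suc)
  finally show ?case using 3 card_sel_upto_add4[of "2 * n"]
    by (simp add: algebra_simps numeral_eq_Suc)
qed

section \<open>The Moore bound and the weights as Fibonacci numbers\<close>

lemma moore_bound_bip11_fib: "moore_bound_bip11 (Suc n) = 2 * (real (fib (n + 3)) - 1)"
proof (induction n rule: fib.induct)
  case 1
  show ?case using moore_bound_bip11_rec(1) by (simp add: numeral_eq_Suc)
next
  case 2
  show ?case using moore_bound_bip11_rec(2) by (simp add: numeral_eq_Suc)
next
  case (3 n)
  then show ?case using moore_bound_bip11_rec(3)[of "Suc n"] by (simp add: numeral_eq_Suc)
qed

lemma binet: "1 / (2 ^ n * sqrt 5) * ((1 + sqrt 5) ^ n - (1 - sqrt 5) ^ n) = real (fib n)"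
  by (simp add: fib_closed_form power_divide field_simps)

text \<open>For \<open>n >= 2\<close> one has \<open>n <= 3 * (n div 2)\<close>. This fails at
  \<open>n = 1\<close>, so only chains with at least two words are compared.\<close>

lemma ceiling_third_le: "n \<ge> 2 \<Longrightarrow> \<lceil>real n / 3\<rceil> \<le> int (n div 2)"
proof -
  assume "n \<ge> 2"
  then have "n \<le> n div 2 * 3" by arith
  then have "real n \<le> real (n div 2 * 3)" by (simp only: of_nat_le_iff)
  then show ?thesis by (simp add: ceiling_le_iff)
qed

section \<open>Redundant words of an edge-arc action\<close>

text \<open>\<open>a\<close> follows the edge at a vertex, \<open>f\<close> its outgoing arc;
  \<open>side\<close> is the colour class and \<open>reach\<close> encodes diameter at most
  \<open>k\<close>.\<close>

locale edge_arc_action =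
  fixes V :: "'a set" and a f :: "'a \<Rightarrow> 'a" and side :: "'a \<Rightarrow> bool" and k :: nat
  assumes finite_V: "finite V"
    and a_V: "x \<in> V \<Longrightarrow> a x \<in> V" and f_V: "x \<in> V \<Longrightarrow> f x \<in> V"
    and a_a: "x \<in> V \<Longrightarrow> a (a x) = x" and inj_f: "inj_on f V"
    and side_a: "x \<in> V \<Longrightarrow> side (a x) \<longleftrightarrow> \<not> side x"
    and side_f: "x \<in> V \<Longrightarrow> side (f x) \<longleftrightarrow> \<not> side x"
    and reach: "x \<in> V \<Longrightarrow> y \<in> V \<Longrightarrow>
      \<exists>W. reduced W \<and> length W \<le> k \<and> foldl (\<lambda>x c. if c then a x else f x) x W = y"
    and k_ge: "k \<ge> 3"
begin

abbreviation act :: "'a \<Rightarrow> bool list \<Rightarrow> 'a" where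
  "act \<equiv> foldl (\<lambda>x c. if c then a x else f x)"

lemma act_V: "x \<in> V \<Longrightarrow> act x W \<in> V"
  by (induction W arbitrary: x) (simp_all add: a_V f_V)

lemma side_act: "x \<in> V \<Longrightarrow> side (act x W) \<longleftrightarrow> (side x \<longleftrightarrow> even (length W))"
  by (induction W arbitrary: x) (auto simp add: a_V f_V side_a side_f)

definition target :: "'a \<Rightarrow> 'a set" where
  "target x = {y \<in> V. side y \<longleftrightarrow> (side x \<longleftrightarrow> even (k - 1))}"

lemma act_parity_words: "x \<in> V \<Longrightarrow> act x ` parity_words (k - 1) = target x"
proof (intro equalityI subsetI)
  fix y assume x: "x \<in> V" and y: "y \<in> target x"
  then obtain W where W: "reduced W" "length W \<le> k" "act x W = y"
    using reach by (auto simp: target_def)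
  have "even (length W) \<longleftrightarrow> even (k - 1)"
    using W(3) y side_act[OF x, of W] by (auto simp: target_def)
  \<comment> \<open>\<open>length W\<close> has the parity of \<open>k - 1\<close>, hence not that
    of \<open>k\<close>.\<close>
  moreover from this have "length W \<noteq> k" using k_ge by auto
  ultimately have "W \<in> parity_words (k - 1)" using W by (auto simp: parity_words_def)
  then show "y \<in> act x ` parity_words (k - 1)" using W(3) by blast
qed (auto simp: target_def parity_words_def act_V side_act)

definition edge_first :: "bool list set" where
  "edge_first = {W \<in> parity_words (k - 1). W = [] \<or> hd W}"

text \<open>Both kinds may be dropped simultaneously: a dropped word of the first kind is covered by an
  edge-first word, and a dropped edge-first word is covered by an arc-first word of length \<open>k - 1\<close>,
  which is too long to be dropped.\<close>

definition redundant_arc :: "'a \<Rightarrow> bool list set" where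
  "redundant_arc r = {g \<in> parity_words (k - 1). g \<noteq> [] \<and> \<not> hd g \<and> length g \<le> k - 3
     \<and> act r g \<in> act r ` edge_first}"

definition redundant_edge :: "'a \<Rightarrow> bool list set" where
  "redundant_edge r = {S \<in> edge_first. \<exists>h\<in>words (k - 1). \<not> hd h \<and> act r S = act r h}"

lemma finite_redundant: "finite (redundant_arc r)" "finite (redundant_edge r)"
  by (rule finite_subset[of _ "parity_words (k - 1)"];
    use finite_card_parity_words in \<open>auto simp: redundant_arc_def redundant_edge_def edge_first_def\<close>)+

lemma redundant_edgeI:
  "S \<in> edge_first \<Longrightarrow> h \<in> words (k - 1) \<Longrightarrow> \<not> hd h \<Longrightarrow> act r S = act r h \<Longrightarrow> S \<in> redundant_edge r"
  unfolding redundant_edge_def by blast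

lemma card_target_le:
  assumes "r \<in> V"
  shows "card (target r) + card (redundant_arc r) + card (redundant_edge r)
    \<le> card (parity_words (k - 1))"
proof -
  let ?L = "parity_words (k - 1)" and ?R = "redundant_arc r \<union> redundant_edge r"
  have long: "h \<in> ?L - ?R" if "h \<in> words (k - 1)" "\<not> hd h" for h
    using that k_ge
    by (auto simp: words_def parity_words_def redundant_arc_def redundant_edge_def edge_first_def)
  have edge: "act r S \<in> act r ` (?L - ?R)" if "S \<in> edge_first" for S
  proof (cases "S \<in> redundant_edge r")
    case True
    then show ?thesis using long by (auto simp: redundant_edge_def)
  next
    case False
    then have "S \<in> ?L - ?R" using that by (auto simp: redundant_arc_def edge_first_def)
    then show ?thesis by blast
  qed
  have "act r W \<in> act r ` (?L - ?R)" if "W \<in> ?L" for W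
  proof (cases "W \<in> ?R")
    case True
    then have "act r W \<in> act r ` edge_first"
      by (auto simp: redundant_arc_def redundant_edge_def)
    then show ?thesis using edge by auto
  qed (use that in blast)
  then have "act r ` ?L \<subseteq> act r ` (?L - ?R)" by (rule image_subsetI)
  then have "target r \<subseteq> act r ` (?L - ?R)" by (simp only: act_parity_words[OF assms])
  moreover have fin: "finite ?L" using finite_card_parity_words by blast
  ultimately have "card (target r) \<le> card (?L - ?R)"
    by (meson card_image_le card_mono finite_Diff finite_imageI le_trans)
  moreover have "?R \<subseteq> ?L"
    by (auto simp: redundant_arc_def redundant_edge_def edge_first_def)
  moreover have "card ?R = card (redundant_arc r) + card (redundant_edge r)"
  proof (rule card_Un_disjoint)
    show "redundant_arc r \<inter> redundant_edge r = {}"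
      by (auto simp: redundant_arc_def redundant_edge_def edge_first_def)
  qed (rule finite_redundant)+
  ultimately show ?thesis
    using card_mono[OF fin, of ?R] by (simp add: card_Diff_subset finite_redundant)
qed

text \<open>The three outcomes correspond to the word \<open>W\<close> from \<open>u\<close> being
  shorter than \<open>k - 1\<close>, or of that length and ending in an arc, or in an edge. A final
  arc cancels because \<open>f\<close> is injective, a final edge because \<open>a\<close> is an
  involution.\<close>

lemma arc_word_cases:
  assumes v: "v \<in> V" and g: "g \<in> arc_words n" and n: "n \<le> k - 3" "even n \<longleftrightarrow> even (k - 1)"
  shows "g \<in> redundant_arc v \<or> True # butlast g \<in> redundant_edge (a v)
    \<or> True # g @ [True] \<in> redundant_edge (a v)"
proof -
  define u where "u = f (a v)"
  have uV: "u \<in> V" using v by (simp add: u_def a_V f_V)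
  obtain g' where g': "g = g' @ [False]"
    using g by (cases g rule: rev_cases) (auto simp: arc_words_def)
  have len: "length g = n" and red: "reduced g" and hd: "g \<noteq> []" "\<not> hd g"
    using g by (auto simp: arc_words_def words_def)
  have gL: "g \<in> parity_words (k - 1)" using len red n by (auto simp: parity_words_def)
  have "act v g \<in> target v" using act_parity_words[OF v] gL by blast
  \<comment> \<open>One edge and one arc lead from \<open>v\<close> to \<open>u\<close>, so both lie
    on the same side.\<close>
  also have "target v = target u" using v by (simp add: target_def u_def a_V side_a side_f)
  finally obtain W where W: "W \<in> parity_words (k - 1)" "act v g = act u W"
    using act_parity_words[OF uV] by auto
  show ?thesis
  proof (cases "length W = k - 1")
    case False
    have "length W \<le> k - 1" "even (length W) \<longleftrightarrow> even (k - 1)"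
      using W(1) by (simp_all add: parity_words_def)
    \<comment> \<open>Parity leaves room for two more letters, namely the prefix \<open>af\<close>
      leading from \<open>v\<close> to \<open>u\<close>.\<close>
    with False have "length W + 2 \<le> k - 1" by presburger
    then have "True # False # W \<in> edge_first"
      using W(1) by (auto simp: parity_words_def edge_first_def)
    moreover have "act v g = act v (True # False # W)"
      using W(2) by (simp add: u_def)
    ultimately have "g \<in> redundant_arc v"
      unfolding redundant_arc_def using gL hd len n by blast
    then show ?thesis by blast
  next
    case True
    then obtain W' c where W': "W = W' @ [c]" using k_ge by (cases W rule: rev_cases) auto
    \<comment> \<open>The arc from \<open>a v\<close> to \<open>u\<close> makes up for the cancelled
      letter, so the length is again \<open>k - 1\<close>.\<close>
    have h: "False # W' \<in> words (k - 1)"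
      using W(1) W' True by (auto simp: parity_words_def words_def reduced_append)
    have actW': "act (a v) (False # W') = act u W'" by (simp add: u_def)
    show ?thesis
    proof (cases c)
      case False
      then have "f (act v g') = f (act u W')" using W(2) W' g' by simp
      then have "act v g' = act u W'"
        using inj_f act_V[OF v] act_V[OF uV] by (auto dest: inj_onD)
      then have "act (a v) (True # g') = act (a v) (False # W')"
        using v by (simp add: a_a u_def)
      moreover have "True # g' \<in> edge_first"
        using g' gL hd by (cases g') (auto simp: edge_first_def parity_words_def reduced_append)
      ultimately have "True # g' \<in> redundant_edge (a v)"
        using h by (intro redundant_edgeI) auto
      then show ?thesis by (simp add: g')
    next
      case True
      then have "a (act v g) = act u W'"
        using W(2) W' uV by (simp add: a_a act_V)
      then have "act (a v) (True # g @ [True]) = act (a v) (False # W')"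
        using v by (simp add: a_a u_def)
      \<comment> \<open>This word is two letters longer than \<open>g\<close>, whence the bound
        \<open>k - 3\<close> on \<open>n\<close>.\<close>
      moreover have "True # g @ [True] \<in> edge_first"
        using g gL hd len n k_ge by (auto simp: edge_first_def parity_words_def reduced_append arc_words_def)
      ultimately have "True # g @ [True] \<in> redundant_edge (a v)"
        using h by (intro redundant_edgeI) auto
      then show ?thesis by blast
    qed
  qed
qed

text \<open>Each selected word is sent to a redundant word that it yields. Distinct words could
  collide only if \<open>butlast g2 = g1 @ [True]\<close>, that is, if \<open>g2\<close> is
  \<open>g1\<close> followed by \<open>af\<close>; \<open>sel\<close> excludes this. The disjoint
  sum keeps the roots \<open>v\<close> and \<open>a v\<close> apart.\<close>

lemma card_sel_upto_le:
  assumes v: "v \<in> V"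
  shows "card (sel_upto (k - 3)) \<le> card (redundant_arc v) + card (redundant_edge (a v))"
proof -
  let ?C = "redundant_arc v" and ?E = "redundant_edge (a v)"
  define h where "h g = (if g \<in> ?C then Inl g
    else Inr (if True # butlast g \<in> ?E then True # butlast g else True # g @ [True]))" for g
  have sel: "g \<in> sel (length g)" "g \<in> arc_words (length g)" "length g \<le> k - 3"
    "even (length g) \<longleftrightarrow> even (k - 1)" if "g \<in> sel_upto (k - 3)" for g
    using that sel_subset k_ge by (auto simp: sel_upto_def)
  have "h g \<in> ?C <+> ?E" if "g \<in> sel_upto (k - 3)" for g
    using arc_word_cases[OF v sel(2-4)[OF that]] by (auto simp: h_def)
  then have sub: "h ` sel_upto (k - 3) \<subseteq> ?C <+> ?E" by blast
  have no_ext: False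
    if "g1 \<in> sel_upto (k - 3)" "g2 \<in> sel_upto (k - 3)" "butlast g2 = g1 @ [True]" for g1 g2
  proof -
    have "g2 \<noteq> []" "\<not> last g2" using sel(2)[OF that(2)] by (auto simp: arc_words_def)
    then have g2: "g2 = g1 @ [True, False]"
      using that(3) append_butlast_last_id[of g2] by auto
    with sel(1)[OF that(2)] have "g2 \<in> sel (Suc (Suc (length g1)))" by simp
    with sel(1)[OF that(1)] g2 show False by auto
  qed
  have butlast_inj: "g1 = g2"
    if "g1 \<in> sel_upto (k - 3)" "g2 \<in> sel_upto (k - 3)" "butlast g1 = butlast g2" for g1 g2
  proof -
    have "g1 \<noteq> []" "\<not> last g1" "g2 \<noteq> []" "\<not> last g2"
      using sel(2)[OF that(1)] sel(2)[OF that(2)] by (auto simp: arc_words_def)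
    then show ?thesis
      using that(3) append_butlast_last_id[of g1] append_butlast_last_id[of g2] by auto
  qed
  have "inj_on h (sel_upto (k - 3))"
  proof (rule inj_onI)
    fix g1 g2 assume g: "g1 \<in> sel_upto (k - 3)" "g2 \<in> sel_upto (k - 3)" "h g1 = h g2"
    show "g1 = g2"
      using g(3) no_ext[OF g(1,2)] no_ext[OF g(2,1)] butlast_inj[OF g(1,2)]
      by (auto simp: h_def split: if_splits)
  qed
  then have "card (sel_upto (k - 3)) \<le> card (?C <+> ?E)"
    using sub by (intro card_inj_on_le) (auto simp: finite_redundant)
  also have "\<dots> = card ?C + card ?E" by (simp add: card_Plus finite_redundant)
  finally show ?thesis .
qed

text \<open>The targets of \<open>v\<close> and \<open>a v\<close> are the two sides. Applying
  \<open>card_sel_upto_le\<close> at both ends of the edge pairs the redundant arc-first words of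
  each root with the redundant edge-first words of the other, so each of the four sets is counted
  once.\<close>

lemma card_V_le:
  assumes "v \<in> V"
  shows "card V + 2 * card (sel_upto (k - 3)) + 2 \<le> 2 * fib (k + 2)"
proof -
  have aV: "a v \<in> V" using assms by (rule a_V)
  have "card (target v \<union> target (a v)) = card (target v) + card (target (a v))"
    by (rule card_Un_disjoint) (auto simp: target_def finite_V assms side_a)
  moreover have "target v \<union> target (a v) = V"
    by (auto simp: target_def assms side_a)
  ultimately have "card V = card (target v) + card (target (a v))" by simp
  moreover have "card (parity_words (k - 1)) + 1 = fib (k + 2)"
    using finite_card_parity_words[of "k - 1"] k_ge by (simp add: numeral_eq_Suc)
  ultimately show ?thesis
    using card_target_le[OF assms] card_target_le[OF aV] card_sel_upto_le[OF assms]
      card_sel_upto_le[OF aV] by (simp add: a_a assms)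
qed

end

section \<open>Mixed graphs\<close>

text \<open>A finite bound excludes the empty set, and a nonempty set in \<open>enat\<close> attains
  its infimum.\<close>

lemma Inf_enat_le_obtains:
  fixes A :: "'b set"
  assumes "(INF p\<in>A. enat (g p)) \<le> enat n"
  obtains p where "p \<in> A" "g p \<le> n"
proof -
  have "A \<noteq> {}" using assms by (auto simp: Inf_enat_def)
  then have "(INF p\<in>A. enat (g p)) \<in> (\<lambda>p. enat (g p)) ` A"
    by (meson all_not_in_conv image_is_empty wellorder_InfI)
  then show thesis using assms that by auto
qed

text \<open>Two consecutive edges would return to a vertex already visited. The last conjunct
  strengthens the induction: it identifies the second vertex when the word begins with an
  edge.\<close>

lemma path_word:
  fixes a f :: "'a \<Rightarrow> 'a"
  assumes "p \<noteq> []" "distinct p" "set p \<subseteq> V" "successively R p"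
    and R: "\<And>x y. x \<in> V \<Longrightarrow> R x y \<Longrightarrow> y = a x \<or> y = f x"
    and a_a: "\<And>x. x \<in> V \<Longrightarrow> a (a x) = x"
  shows "\<exists>W. reduced W \<and> length W = length p - 1
    \<and> foldl (\<lambda>x c. if c then a x else f x) (hd p) W = last p
    \<and> (W \<noteq> [] \<and> hd W \<longrightarrow> hd (tl p) = a (hd p))"
  using assms(1-4)
proof (induction p)
  case (Cons x q)
  show ?case
  proof (cases q)
    case Nil
    then show ?thesis by (intro exI[of _ "[]"]) simp
  next
    case q: (Cons y r)
    obtain W where W: "reduced W" "length W = length r"
      "foldl (\<lambda>x c. if c then a x else f x) y W = last q"
      "W \<noteq> [] \<and> hd W \<longrightarrow> hd r = a y"
      using Cons q by auto
    consider "y = f x" | "y = a x" using R[of x y] Cons.prems q by auto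
    then show ?thesis
    proof cases
      case 1
      then show ?thesis using W q by (intro exI[of _ "False # W"]) simp
    next
      case 2
      have "W = [] \<or> \<not> hd W"
      proof (rule ccontr)
        assume "\<not> ?thesis"
        \<comment> \<open>The vertex after \<open>y\<close> would be \<open>a (a x) = x\<close>, a
          repetition.\<close>
        then have "hd r = x" "r \<noteq> []" using W 2 a_a Cons.prems by auto
        then show False using Cons.prems q by (cases r) auto
      qed
      then show ?thesis using W q 2 by (intro exI[of _ "True # W"]) simp
    qed
  qed
qed simp

text \<open>Undirected degree 1 turns the edges into an involution and out-degree 1 the arcs into a
  map, which in-degree 1 makes injective.\<close>

lemma mixed_graph_action:
  assumes G: "mixed_graph G" and reg: "totally_regular G 1 1" and bip: "bipartite G"
    and diam: "diameter G = enat k" and k: "k \<ge> 3"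
  obtains a f side where "edge_arc_action (verts G) a f side k"
proof -
  let ?V = "verts G"
  have "\<exists>y. \<forall>z. {x, z} \<in> edges G \<longleftrightarrow> z = y" if "x \<in> ?V" for x
  proof -
    have "card {e \<in> edges G. x \<in> e} = 1"
      using reg that by (auto simp: totally_regular_def undirected_degree_def)
    then obtain e where e: "{e \<in> edges G. x \<in> e} = {e}" by (rule card_1_singletonE)
    then have "e \<in> edges G" "x \<in> e" by blast+
    then have "card e = 2" using G by (simp add: mixed_graph_def)
    then obtain p q where "e = {p, q}" by (meson card_2_iff)
    with \<open>x \<in> e\<close> obtain y where y: "e = {x, y}" by fastforce
    have "{x, z} \<in> edges G \<longleftrightarrow> z = y" for z
    proof -
      have "{x, z} \<in> edges G \<longleftrightarrow> {x, z} \<in> {e \<in> edges G. x \<in> e}" by simp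
      also have "\<dots> \<longleftrightarrow> z = y" unfolding e y by (auto simp: doubleton_eq_iff)
      finally show ?thesis .
    qed
    then show ?thesis by blast
  qed
  then obtain a where a: "\<And>x z. x \<in> ?V \<Longrightarrow> {x, z} \<in> edges G \<longleftrightarrow> z = a x" by metis
  have "\<exists>y. \<forall>z. (x, z) \<in> arcs G \<longleftrightarrow> z = y" if "x \<in> ?V" for x
  proof -
    have "card {b \<in> arcs G. fst b = x} = 1"
      using reg that by (auto simp: totally_regular_def out_degree_def)
    then obtain b where b: "{b \<in> arcs G. fst b = x} = {b}" by (rule card_1_singletonE)
    then have "fst b = x" by blast
    have "(x, z) \<in> arcs G \<longleftrightarrow> z = snd b" for z
    proof -
      have "(x, z) \<in> arcs G \<longleftrightarrow> (x, z) \<in> {b \<in> arcs G. fst b = x}" by simp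
      also have "\<dots> \<longleftrightarrow> z = snd b" unfolding b using \<open>fst b = x\<close> by (auto simp: prod_eq_iff)
      finally show ?thesis .
    qed
    then show ?thesis by blast
  qed
  then obtain f where f: "\<And>x z. x \<in> ?V \<Longrightarrow> (x, z) \<in> arcs G \<longleftrightarrow> z = f x" by metis
  obtain X Y where XY: "X \<union> Y = ?V" "X \<inter> Y = {}"
    "\<forall>e\<in>edges G. \<exists>x\<in>X. \<exists>y\<in>Y. e = {x, y}"
    "\<forall>(u, v)\<in>arcs G. u \<in> X \<and> v \<in> Y \<or> u \<in> Y \<and> v \<in> X"
    using bip unfolding bipartite_def by (elim exE conjE) (rule that)
  have aV: "a x \<in> ?V" if "x \<in> ?V" for x
  proof -
    have "{x, a x} \<in> edges G" using a that by blast
    then show ?thesis using G by (auto simp: mixed_graph_def)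
  qed
  have fV: "f x \<in> ?V" if "x \<in> ?V" for x
  proof -
    have "(x, f x) \<in> arcs G" using f that by blast
    then show ?thesis using G by (auto simp: mixed_graph_def)
  qed
  have aa: "a (a x) = x" if "x \<in> ?V" for x
  proof -
    have "{x, a x} \<in> edges G" using a that by blast
    then have "{a x, x} \<in> edges G" by (simp add: insert_commute)
    then show ?thesis using a[OF aV[OF that]] by simp
  qed
  have "edge_arc_action ?V a f (\<lambda>x. x \<in> X) k"
  proof
    show "finite ?V" using G by (simp add: mixed_graph_def)
    show "inj_on f ?V"
    proof (rule inj_onI)
      fix x y assume xy: "x \<in> ?V" "y \<in> ?V" "f x = f y"
      have "card {b \<in> arcs G. snd b = f x} = 1"
        using reg fV[OF xy(1)] by (auto simp: totally_regular_def in_degree_def)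
      then obtain b where b: "{b \<in> arcs G. snd b = f x} = {b}" by (rule card_1_singletonE)
      have "(x, f x) \<in> {b \<in> arcs G. snd b = f x}" "(y, f x) \<in> {b \<in> arcs G. snd b = f x}"
        using f xy by auto
      then show "x = y" unfolding b by auto
    qed
    show "a x \<in> X \<longleftrightarrow> x \<notin> X" if "x \<in> ?V" for x
    proof -
      have "{x, a x} \<in> edges G" using a that by blast
      then obtain y z where "y \<in> X" "z \<in> Y" "{x, a x} = {y, z}" using XY(3) by blast
      then show ?thesis using XY(2) by (auto simp: doubleton_eq_iff)
    qed
    show "f x \<in> X \<longleftrightarrow> x \<notin> X" if "x \<in> ?V" for x
    proof -
      have "(x, f x) \<in> arcs G" using f that by blast
      then show ?thesis using XY(2,4) by fast
    qed
    show "\<exists>W. reduced W \<and> length W \<le> k \<and> foldl (\<lambda>x c. if c then a x else f x) x W = y"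
      if xy: "x \<in> ?V" "y \<in> ?V" for x y
    proof -
      have "distance G x y \<le> diameter G"
        unfolding diameter_def using xy by (intro SUP_upper2[of "(x, y)"]) auto
      then have "distance G x y \<le> enat k" by (simp add: diam)
      then obtain p where p: "is_path G x p y" "length p - 1 \<le> k"
        unfolding distance_def by (rule Inf_enat_le_obtains) auto
      have "z = a w \<or> z = f w" if "w \<in> ?V" "step G w z" for w z
        using that a f by (auto simp: step_def)
      then have "\<exists>W. reduced W \<and> length W = length p - 1
        \<and> foldl (\<lambda>x c. if c then a x else f x) (hd p) W = last p
        \<and> (W \<noteq> [] \<and> hd W \<longrightarrow> hd (tl p) = a (hd p))"
        using p(1) aa by (intro path_word[of p ?V "step G"]) (auto simp: is_path_def)
      then show ?thesis using p by (auto simp: is_path_def)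
    qed
  qed (fact aV fV aa k)+
  then show thesis by (rule that)
qed

lemma card_verts_le:
  assumes "mixed_graph G" "totally_regular G 1 1" "bipartite G" "diameter G = enat k" "k \<ge> 3"
  shows "real (card (verts G)) \<le> moore_bound_bip11 k - 2 * real (card (sel_upto (k - 3)))"
proof -
  obtain a f side where "edge_arc_action (verts G) a f side k"
    using mixed_graph_action[OF assms] .
  then interpret edge_arc_action "verts G" a f side k .
  \<comment> \<open>The supremum over no pairs is 0, so a positive diameter provides a root.\<close>
  have "diameter G \<noteq> 0" using assms(4,5) by (auto simp: zero_enat_def)
  then have "verts G \<noteq> {}" by (auto simp: diameter_def bot_enat_def)
  then obtain v where "v \<in> verts G" by blast
  from card_V_le[OF this]
  have "real (card (verts G)) + 2 * real (card (sel_upto (k - 3))) + 2 \<le> 2 * real (fib (k + 2))"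
    by linarith
  moreover have "moore_bound_bip11 k = 2 * (real (fib (k + 2)) - 1)"
    using moore_bound_bip11_fib[of "k - 1"] assms(5) by (simp add: numeral_eq_Suc)
  ultimately show ?thesis by simp
qed

section \<open>Comparison with the deficits of the theorem\<close>

text \<open>With \<open>j = t - 1\<close>, the numerator \<open>\<kappa> - t + 1\<close> is the
  number of words in a chain and is at least 2 throughout the sum, so
  \<open>ceiling_third_le\<close> applies to each term.\<close>

lemma even_deficit_le:
  assumes "\<kappa> \<ge> 2"
  shows "of_int \<lceil>real \<kappa> / 3\<rceil> + (\<Sum>t = 2..\<kappa> - 1. 1 / (2 ^ (2 * t - 2) * sqrt 5)
      * ((1 + sqrt 5) ^ (2 * t - 2) - (1 - sqrt 5) ^ (2 * t - 2))
      * of_int \<lceil>(real \<kappa> - real t + 1) / 3\<rceil>) \<le> real (card (sel_upto (2 * \<kappa> - 3)))"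
proof -
  let ?c = "\<lambda>j. fib (2 * j) * ((\<kappa> - j) div 2)"
  have "(\<Sum>t = 2..\<kappa> - 1. real (fib (2 * t - 2)) * of_int \<lceil>(real \<kappa> - real t + 1) / 3\<rceil>)
      \<le> (\<Sum>t = 2..\<kappa> - 1. real (?c (t - 1)))"
  proof (rule sum_mono)
    fix t assume t: "t \<in> {2..\<kappa> - 1}"
    then have "\<lceil>real (\<kappa> - (t - 1)) / 3\<rceil> \<le> int ((\<kappa> - (t - 1)) div 2)"
      by (intro ceiling_third_le) auto
    moreover have "real (\<kappa> - (t - 1)) = real \<kappa> - real t + 1" using t by (auto simp: of_nat_diff)
    ultimately have "real_of_int \<lceil>(real \<kappa> - real t + 1) / 3\<rceil> \<le> real ((\<kappa> - (t - 1)) div 2)"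
      by (metis of_int_le_iff of_int_of_nat_eq)
    moreover have "2 * t - 2 = 2 * (t - 1)" by simp
    ultimately show "real (fib (2 * t - 2)) * of_int \<lceil>(real \<kappa> - real t + 1) / 3\<rceil> \<le> real (?c (t - 1))"
      by (simp add: mult_left_mono)
  qed
  also have "\<dots> = real (\<Sum>j\<in>(\<lambda>t. t - 1) ` {2..\<kappa> - 1}. ?c j)"
    by (subst sum.reindex) (auto simp: inj_on_def)
  also have "\<dots> \<le> real (\<Sum>j\<le>\<kappa>. ?c j)"
    by (intro of_nat_mono sum_mono2) auto
  also have "of_int \<lceil>real \<kappa> / 3\<rceil> \<le> real (\<kappa> div 2)"
    using ceiling_third_le[OF assms] by (metis of_int_le_iff of_int_of_nat_eq)
  moreover have "\<kappa> div 2 + (\<Sum>j\<le>\<kappa>. ?c j) = card (sel_upto (2 * \<kappa> - 3))"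
  proof -
    obtain n where n: "\<kappa> = n + 2" using assms by (metis le_add_diff_inverse2)
    then have "2 * \<kappa> - 3 = 2 * n + 1" by simp
    then show ?thesis using card_sel_upto_odd[of n] n by simp
  qed
  ultimately show ?thesis unfolding binet by linarith
qed

text \<open>The same comparison for the \<open>fib (2 * t - 1)\<close> chains that start at the even
  length \<open>2 * t\<close>.\<close>

lemma odd_deficit_le:
  assumes "\<kappa> \<ge> 2"
  shows "(\<Sum>t = 1..\<kappa> - 1. 1 / (2 ^ (2 * t - 1) * sqrt 5)
      * ((1 + sqrt 5) ^ (2 * t - 1) - (1 - sqrt 5) ^ (2 * t - 1))
      * of_int \<lceil>(real \<kappa> - real t + 1) / 3\<rceil>) \<le> real (card (sel_upto (2 * \<kappa> - 2)))"
proof -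
  let ?c = "\<lambda>j. fib (2 * j + 1) * ((\<kappa> - j) div 2)"
  have "(\<Sum>t = 1..\<kappa> - 1. real (fib (2 * t - 1)) * of_int \<lceil>(real \<kappa> - real t + 1) / 3\<rceil>)
      \<le> (\<Sum>t = 1..\<kappa> - 1. real (?c (t - 1)))"
  proof (rule sum_mono)
    fix t assume t: "t \<in> {1..\<kappa> - 1}"
    then have "\<lceil>real (\<kappa> - (t - 1)) / 3\<rceil> \<le> int ((\<kappa> - (t - 1)) div 2)"
      by (intro ceiling_third_le) auto
    moreover have "real (\<kappa> - (t - 1)) = real \<kappa> - real t + 1" using t by (auto simp: of_nat_diff)
    ultimately have "real_of_int \<lceil>(real \<kappa> - real t + 1) / 3\<rceil> \<le> real ((\<kappa> - (t - 1)) div 2)"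
      by (metis of_int_le_iff of_int_of_nat_eq)
    moreover have "2 * t - 1 = 2 * (t - 1) + 1"
      using t by (simp only: atLeastAtMost_iff) presburger
    ultimately show "real (fib (2 * t - 1)) * of_int \<lceil>(real \<kappa> - real t + 1) / 3\<rceil> \<le> real (?c (t - 1))"
      by (simp add: mult_left_mono)
  qed
  also have "\<dots> = real (\<Sum>j\<in>(\<lambda>t. t - 1) ` {1..\<kappa> - 1}. ?c j)"
    by (subst sum.reindex) (auto simp: inj_on_def)
  also have "\<dots> \<le> real (\<Sum>j\<le>\<kappa> - 1. ?c j)"
    by (intro of_nat_mono sum_mono2) auto
  also have "(\<Sum>j\<le>\<kappa> - 1. ?c j) = card (sel_upto (2 * \<kappa> - 2))"
    using card_sel_upto_even[of "\<kappa> - 1"] assms by (simp add: diff_mult_distrib2)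
  finally show ?thesis unfolding binet .
qed

theorem theorem5p1:
  fixes G :: "'a mixed_graph" and k \<kappa> N :: nat
  assumes "mixed_graph G"
    and "totally_regular G 1 1"
    and "bipartite G"
    and "diameter G = enat k"
    and "N = card (verts G)"
  shows "(k = 2 * \<kappa> \<and> \<kappa> \<ge> 3 \<longrightarrow>
           real N \<le> moore_bound_bip11 (2 * \<kappa>) - 2 * of_int \<lceil>real \<kappa> / 3\<rceil>
             - 2 * (\<Sum>t = 2..\<kappa> - 1. 1 / (2 ^ (2 * t - 2) * sqrt 5)
                     * ((1 + sqrt 5) ^ (2 * t - 2) - (1 - sqrt 5) ^ (2 * t - 2))
                     * of_int \<lceil>(real \<kappa> - real t + 1) / 3\<rceil>))
       \<and> (k = 2 * \<kappa> \<and> \<kappa> = 2 \<longrightarrow>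
           real N \<le> moore_bound_bip11 (2 * \<kappa>) - 2 * of_int \<lceil>real \<kappa> / 3\<rceil>)
       \<and> (k = 2 * \<kappa> + 1 \<and> \<kappa> \<ge> 2 \<longrightarrow>
           real N \<le> moore_bound_bip11 (2 * \<kappa> + 1)
             - 2 * (\<Sum>t = 1..\<kappa> - 1. 1 / (2 ^ (2 * t - 1) * sqrt 5)
                     * ((1 + sqrt 5) ^ (2 * t - 1) - (1 - sqrt 5) ^ (2 * t - 1))
                     * of_int \<lceil>(real \<kappa> - real t + 1) / 3\<rceil>))"
proof -
  have N: "k \<ge> 3 \<Longrightarrow> real N \<le> moore_bound_bip11 k - 2 * real (card (sel_upto (k - 3)))"
    using card_verts_le assms by blast
  show ?thesis
  proof (intro conjI impI; elim conjE)
    assume "k = 2 * \<kappa>" "\<kappa> \<ge> 3"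
    then show "real N \<le> moore_bound_bip11 (2 * \<kappa>) - 2 * of_int \<lceil>real \<kappa> / 3\<rceil>
             - 2 * (\<Sum>t = 2..\<kappa> - 1. 1 / (2 ^ (2 * t - 2) * sqrt 5)
                     * ((1 + sqrt 5) ^ (2 * t - 2) - (1 - sqrt 5) ^ (2 * t - 2))
                     * of_int \<lceil>(real \<kappa> - real t + 1) / 3\<rceil>)"
      using N even_deficit_le[of \<kappa>] by (simp only:) linarith
  next
    assume k: "k = 2 * \<kappa>" "\<kappa> = 2"
    \<comment> \<open>The sum over \<open>{2..1}\<close> is empty, so only the first term of the
      even deficit remains.\<close>
    have "of_int \<lceil>real \<kappa> / 3\<rceil> \<le> real (card (sel_upto (k - 3)))"
      using even_deficit_le[of \<kappa>] k by simp
    then show "real N \<le> moore_bound_bip11 (2 * \<kappa>) - 2 * of_int \<lceil>real \<kappa> / 3\<rceil>"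
      using N k by simp
  next
    assume k: "k = 2 * \<kappa> + 1" "\<kappa> \<ge> 2"
    then have "k - 3 = 2 * \<kappa> - 2" by simp
    then show "real N \<le> moore_bound_bip11 (2 * \<kappa> + 1)
             - 2 * (\<Sum>t = 1..\<kappa> - 1. 1 / (2 ^ (2 * t - 1) * sqrt 5)
                     * ((1 + sqrt 5) ^ (2 * t - 1) - (1 - sqrt 5) ^ (2 * t - 1))
                     * of_int \<lceil>(real \<kappa> - real t + 1) / 3\<rceil>)"
      using N k odd_deficit_le[OF k(2)] by simp
  qed
qed

end
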